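(* Let $G=(V,E)$ be a finite simple graph with $V\neq\emptyset$ and let $\mathcal{C}\subseteq V$ be an independent set of $G$. Then $$\operatorname{vol}(\mathbf{S}(G,\mathcal{C}))=\Big(\prod_{x\in V}\frac{1}{|N_{\mathcal{C}}(x)|+1}\Big)\operatorname{vol}(\Delta(V)).$$
   Context: Graphs are simple (no loops, no multiple edges) and undirected; $x\sim y$ means $(x,y)\in E$. A set of nodes is independent if it contains no two adjacent nodes. $\Delta(V)=\{p\in\mathbb{R}^V : p_x\ge 0 \text{ for all } x\in V,\ \sum_{x\in V}p_x=1\}$ is the set of probability distributions on $V$. A point $x\in V$ is a strong mode of $p\in\Delta(V)$ if $p_x\ge\sum_{y\sim x}p_y$ (sum over all neighbors $y$ of $x$). The polytope of strong $\mathcal{C}$-modes in $G$ is $\mathbf{S}(G,\mathcal{C})=\{p\in\Delta(V): \text{every } x\in\mathcal{C}\text{ is a strong mode of } p\}$. For $x\in V$, $N_{\mathcal{C}}(x)=\{y\in\mathcal{C}: y\sim x\}$. $\operatorname{vol}$ denotes the $(|V|-1)$-dimensional volume in the affine hyperplane $\{p\in\mathbb{R}^V:\sum_{x}p_x=1\}$. *)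

theory Defs
  imports "HOL-Analysis.Analysis"
begin

definition orthonormal_basis_of :: "'a::euclidean_space set \<Rightarrow> 'a set \<Rightarrow> bool" where
  "orthonormal_basis_of W B \<longleftrightarrow>
     pairwise orthogonal B \<and> (\<forall>b\<in>B. norm b = 1) \<and> span B = W"

lemma orthonormal_basis_of_exists:
  assumes "subspace W"
  shows "\<exists>B. finite B \<and> orthonormal_basis_of W B"
  using orthonormal_basis_subspace[OF assms] independent_imp_finite
  unfolding orthonormal_basis_of_def by metis

(* Lebesgue measure of the (nonempty) affine subspace H with the induced Euclidean
   metric, as a Borel measure on the ambient space: the push-forward of the product
   Lebesgue measure under the isometric parametrization c \<mapsto> a + (\<Sum>b\<in>B. c b *\<^sub>R b) of H,
   where a is a point of H and B an orthonormal basis of the direction space of H.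
   By translation and rotation invariance the choice of a and B is immaterial.
   If H is a single point, then B = {} and this is the unit mass at that point. *)
definition affine_lborel :: "'a::euclidean_space set \<Rightarrow> 'a measure" where
  "affine_lborel H =
     (let a = (SOME a. a \<in> H);
          B = (SOME B. orthonormal_basis_of ((\<lambda>x. x - a) ` H) B)
      in distr (\<Pi>\<^sub>M b\<in>B. (lborel :: real measure)) borel (\<lambda>c. a + (\<Sum>b\<in>B. c b *\<^sub>R b)))"

(* For an affine H the choices in affine_lborel never fail. *)
lemma affine_lborel_choice:
  fixes H :: "'a::euclidean_space set"
  assumes "affine H" "H \<noteq> {}"
  shows "\<exists>a B. a \<in> H \<and> finite B \<and> orthonormal_basis_of ((\<lambda>x. x - a) ` H) B \<and>
    affine_lborel H =
      distr (\<Pi>\<^sub>M b\<in>B. (lborel :: real measure)) borel (\<lambda>c. a + (\<Sum>b\<in>B. c b *\<^sub>R b))"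
proof -
  define a where "a = (SOME a. a \<in> H)"
  have a: "a \<in> H"
    unfolding a_def using assms(2) by (auto intro: someI)
  have "subspace ((\<lambda>x. x - a) ` H)"
    using affine_diffs_subspace_subtract[OF assms(1) a] by (simp add: image_def)
  define B where "B = (SOME B. orthonormal_basis_of ((\<lambda>x. x - a) ` H) B)"
  have B: "orthonormal_basis_of ((\<lambda>x. x - a) ` H) B"
    unfolding B_def
    using orthonormal_basis_of_exists[OF \<open>subspace ((\<lambda>x. x - a) ` H)\<close>] by (metis someI)
  have "0 \<notin> B"
    using B by (auto simp: orthonormal_basis_of_def)
  then have "finite B"
    using B pairwise_orthogonal_independent independent_imp_finite
    unfolding orthonormal_basis_of_def by blast
  moreover have "affine_lborel H =
      distr (\<Pi>\<^sub>M b\<in>B. (lborel :: real measure)) borel (\<lambda>c. a + (\<Sum>b\<in>B. c b *\<^sub>R b))"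
    by (simp add: affine_lborel_def Let_def a_def B_def)
  ultimately show ?thesis
    using a B by blast
qed

(* The vertex set of a graph is a finite (hence nonempty) type; its edge set is given
   by an adjacency relation, which is symmetric and irreflexive for simple graphs. *)

definition independent_set :: "('v \<Rightarrow> 'v \<Rightarrow> bool) \<Rightarrow> 'v set \<Rightarrow> bool" where
  "independent_set adj C \<longleftrightarrow> (\<forall>x\<in>C. \<forall>y\<in>C. \<not> adj x y)"

definition nbrs_in :: "('v \<Rightarrow> 'v \<Rightarrow> bool) \<Rightarrow> 'v set \<Rightarrow> 'v \<Rightarrow> 'v set" where
  "nbrs_in adj C x = {y \<in> C. adj y x}"

definition prob_hyperplane :: "(real ^ 'v::finite) set" where
  "prob_hyperplane = {p. (\<Sum>x\<in>UNIV. p $ x) = 1}"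

definition prob_simplex :: "(real ^ 'v::finite) set" where
  "prob_simplex = {p. (\<forall>x. 0 \<le> p $ x) \<and> (\<Sum>x\<in>UNIV. p $ x) = 1}"

definition strong_mode :: "('v \<Rightarrow> 'v \<Rightarrow> bool) \<Rightarrow> real ^ 'v::finite \<Rightarrow> 'v \<Rightarrow> bool" where
  "strong_mode adj p x \<longleftrightarrow> p $ x \<ge> (\<Sum>y | adj y x. p $ y)"

definition strong_mode_polytope ::
    "('v \<Rightarrow> 'v \<Rightarrow> bool) \<Rightarrow> 'v set \<Rightarrow> (real ^ 'v::finite) set" where
  "strong_mode_polytope adj C = {p \<in> prob_simplex. \<forall>x\<in>C. strong_mode adj p x}"

lemma affine_prob_hyperplane: "affine (prob_hyperplane :: (real ^ 'v::finite) set)"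
  by (auto simp: affine_def prob_hyperplane_def sum.distrib simp flip: sum_distrib_left)

lemma prob_hyperplane_nonempty: "(prob_hyperplane :: (real ^ 'v::finite) set) \<noteq> {}"
proof -
  have "axis (undefined :: 'v) 1 \<in> prob_hyperplane"
    by (simp add: prob_hyperplane_def axis_def)
  then show ?thesis by blast
qed

definition vol :: "(real ^ 'v::finite) set \<Rightarrow> real" where
  "vol A = measure (affine_lborel prob_hyperplane) A"

end

theory Submission
  imports Defs
begin

text \<open>Write d(x) for the number of neighbours of x in C, and let L be the linear map that multiplies the
  coordinate of p at x by d(x) + 1 and, if x is in C, subtracts the sum of p over the neighbours of x. Since C
  is independent, L preserves the coordinate sum, the preimage of the simplex under L is the polytope, L fixes
  the unit vector at each point of C, and L is conjugate to the diagonal map with entries d(x) + 1. By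
  uniqueness of translation-invariant measures, conjugate maps scale Lebesgue measure by the same factor, so no
  determinant is needed, and the volume of a subset of the hyperplane is proportional to the Lebesgue measure of
  the cylinder over it in the direction of a fixed unit vector. If that vector is the one at a point of C,
  preimages under L of cylinders are cylinders.\<close>

section \<open>Translation-invariant measures and linear maps\<close>

text \<open>Boxes determine a product measure, and a shift preserves the length of each side of a
  box. With basis vectors as indices, this gives invariance under translations of the ambient
  space.\<close>

lemma PiM_lborel_translate:
  fixes t :: "'i \<Rightarrow> real"
  assumes I: "finite I"
  shows "distr (\<Pi>\<^sub>M i\<in>I. (lborel :: real measure)) (\<Pi>\<^sub>M i\<in>I. lborel) (\<lambda>c. \<lambda>i\<in>I. t i + c i) =
    (\<Pi>\<^sub>M i\<in>I. lborel)"
proof -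
  interpret product_sigma_finite "\<lambda>_. lborel :: real measure" ..
  show ?thesis
  proof (rule PiM_eqI)
    fix A :: "'i \<Rightarrow> real set"
    assume A: "\<And>i. i \<in> I \<Longrightarrow> A i \<in> sets lborel"
    have [measurable]: "(\<lambda>c. \<lambda>i\<in>I. t i + c i) \<in> (\<Pi>\<^sub>M i\<in>I. (lborel :: real measure)) \<rightarrow>\<^sub>M (\<Pi>\<^sub>M i\<in>I. lborel)"
      by measurable
    have shift: "(+) (t i) -` A i \<in> sets lborel" if "i \<in> I" for i
      using measurable_sets[of "(+) (t i)" borel borel "A i"] A[OF that] by simp
    have pre: "(\<lambda>c. \<lambda>i\<in>I. t i + c i) -` Pi\<^sub>E I A \<inter> space (\<Pi>\<^sub>M i\<in>I. (lborel :: real measure)) =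
      Pi\<^sub>E I (\<lambda>i. (+) (t i) -` A i)"
      by (auto simp: space_PiM PiE_def Pi_def)
    have "emeasure lborel ((+) (t i) -` A i) = emeasure lborel (A i)" if "i \<in> I" for i
    proof -
      have "emeasure lborel (A i) = emeasure (distr lborel borel ((+) (t i))) (A i)"
        by (simp add: lborel_distr_plus)
      then show ?thesis
        using A[OF that] by (simp add: emeasure_distr)
    qed
    then show "emeasure (distr (\<Pi>\<^sub>M i\<in>I. lborel) (\<Pi>\<^sub>M i\<in>I. lborel) (\<lambda>c. \<lambda>i\<in>I. t i + c i)) (Pi\<^sub>E I A) =
      (\<Prod>i\<in>I. emeasure lborel (A i))"
      using A shift I by (simp add: emeasure_distr sets_PiM_I_finite pre emeasure_PiM cong: prod.cong)
  qed (use I in simp_all)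
qed

text \<open>Integrate the indicator of \<^term>\<open>X\<close> at \<^term>\<open>y + f c\<close>, with \<^term>\<open>y\<close> in a ball, and exchange the two
  integrations.\<close>
lemma translation_invariant_eq_scaled_lborel:
  fixes f :: "'b \<Rightarrow> 'a::euclidean_space"
  assumes "sigma_finite_measure M"
    and f [measurable]: "f \<in> borel_measurable M"
    and inv: "\<And>v X. X \<in> sets borel \<Longrightarrow>
      emeasure M {c \<in> space M. v + f c \<in> X} = emeasure M {c \<in> space M. f c \<in> X}"
  obtains k where "\<And>X. X \<in> sets borel \<Longrightarrow> emeasure M {c \<in> space M. f c \<in> X} = k * emeasure lborel X"
proof
  fix X :: "'a set"
  assume X [measurable]: "X \<in> sets borel"
  interpret M: sigma_finite_measure M by fact
  interpret pair_sigma_finite M lborel ..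
  let ?B = "cball 0 1 :: 'a set"
  have B [measurable]: "?B \<in> sets borel" by simp
  define b where "b = emeasure lborel ?B"
  define m where "m = emeasure M {c \<in> space M. f c \<in> ?B}"
  have int: "(\<integral>\<^sup>+c. indicator Y (v + f c) \<partial>M) = emeasure M {c \<in> space M. f c \<in> Y}"
    if [measurable]: "Y \<in> sets borel" for v Y
  proof -
    have "(\<integral>\<^sup>+c. indicator Y (v + f c) \<partial>M) = (\<integral>\<^sup>+c. indicator {c \<in> space M. v + f c \<in> Y} c \<partial>M)"
      by (rule nn_integral_cong) (auto simp: indicator_def)
    then show ?thesis by (simp add: inv)
  qed
  have "emeasure M {c \<in> space M. f c \<in> X} * b =
      (\<integral>\<^sup>+y. emeasure M {c \<in> space M. f c \<in> X} * indicator ?B y \<partial>lborel)"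
    by (simp add: b_def nn_integral_cmult_indicator)
  also have "\<dots> = (\<integral>\<^sup>+y. (\<integral>\<^sup>+c. indicator ?B y * indicator X (y + f c) \<partial>M) \<partial>lborel)"
    by (simp add: nn_integral_cmult int mult.commute)
  also have "\<dots> = (\<integral>\<^sup>+c. (\<integral>\<^sup>+y. indicator ?B y * indicator X (y + f c) \<partial>lborel) \<partial>M)"
    by (rule Fubini') measurable
  \<comment> \<open>Substituting \<open>y - f c\<close> for \<open>y\<close> moves
    \<open>f c\<close> from the indicator of \<open>X\<close> to that of the ball, by invariance of
    \<open>lborel\<close>.\<close>
  also have "\<dots> = (\<integral>\<^sup>+c. (\<integral>\<^sup>+y. indicator ?B (y - f c) * indicator X y \<partial>lborel) \<partial>M)"
  proof (rule nn_integral_cong)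
    fix c
    have "(\<integral>\<^sup>+y. indicator ?B (y - f c) * indicator X y \<partial>lborel) =
      (\<integral>\<^sup>+y. indicator ?B (y - f c) * indicator X y \<partial>distr lborel borel ((+) (f c)))"
      by (simp add: lborel_distr_plus)
    then show "(\<integral>\<^sup>+y. indicator ?B y * indicator X (y + f c) \<partial>lborel) =
      (\<integral>\<^sup>+y. indicator ?B (y - f c) * indicator X y \<partial>lborel)"
      by (simp add: nn_integral_distr add.commute)
  qed
  also have "\<dots> = (\<integral>\<^sup>+y. (\<integral>\<^sup>+c. indicator ?B (y - f c) * indicator X y \<partial>M) \<partial>lborel)"
    by (rule Fubini'[symmetric]) measurable
  \<comment> \<open>The ball is symmetric about 0, so it contains \<open>y - f c\<close> iff it
    contains \<open>- y + f c\<close>; then \<open>inv\<close> applies with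
    \<open>v = - y\<close>.\<close>
  also have "\<dots> = (\<integral>\<^sup>+y. (\<integral>\<^sup>+c. indicator X y * indicator ?B (- y + f c) \<partial>M) \<partial>lborel)"
    by (intro nn_integral_cong) (auto simp: indicator_def norm_minus_commute)
  also have "\<dots> = m * emeasure lborel X"
  proof -
    have "(\<integral>\<^sup>+c. indicator ?B (f c - y) \<partial>M) = m" for y
      using int[OF B, of "- y"] by (simp add: m_def)
    then have "(\<integral>\<^sup>+c. indicator X y * indicator ?B (- y + f c) \<partial>M) = m * indicator X y" for y
      by (simp add: nn_integral_cmult mult.commute)
    then show ?thesis by (simp only:) (simp add: nn_integral_cmult_indicator)
  qed
  finally have eq: "emeasure M {c \<in> space M. f c \<in> X} * b = m * emeasure lborel X" .
  \<comment> \<open>The ball serves as test set because its measure can be divided by in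
    \<open>ennreal\<close>. The constant is then \<open>m / b\<close>, in which \<open>X\<close>
    does not occur.\<close>
  have b: "b \<noteq> 0" "b \<noteq> top"
  proof -
    have "b \<ge> emeasure lborel (ball 0 1 :: 'a set)"
      unfolding b_def by (rule emeasure_mono) auto
    moreover have "emeasure lborel (ball 0 1 :: 'a set) \<noteq> 0"
      using open_not_negligible[of "ball 0 1 :: 'a set"]
      by (auto simp: negligible_iff_emeasure0)
    ultimately show "b \<noteq> 0" by auto
    show "b \<noteq> top"
      unfolding b_def using emeasure_bounded_finite[of ?B] by simp
  qed
  have "emeasure M {c \<in> space M. f c \<in> X} = emeasure M {c \<in> space M. f c \<in> X} * b / b"
    by (rule ennreal_mult_divide_eq[OF b, symmetric])
  also have "\<dots> = m / b * emeasure lborel X"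
    unfolding eq by (simp only: mult.commute[of m] mult.commute[of "m / b"] ennreal_times_divide)
  finally show "emeasure M {c \<in> space M. f c \<in> X} = m / b * emeasure lborel X" .
qed

text \<open>By surjectivity every vector is some \<open>f w\<close>, and translating by
  \<open>f w\<close> after \<open>f\<close> is translating by \<open>w\<close> before it. So the
  push-forward of \<open>lborel\<close> under \<open>f\<close> is translation invariant.\<close>

lemma linear_vimage_eq_scaled_lborel:
  fixes f :: "'a::euclidean_space \<Rightarrow> 'a"
  assumes "linear f" "surj f"
  obtains k where "\<And>X. X \<in> sets borel \<Longrightarrow> emeasure lborel (f -` X) = k * emeasure lborel X"
proof -
  have [measurable]: "f \<in> borel_measurable borel"
    using assms(1) by (simp add: borel_measurable_continuous_onI linear_continuous_on linear_linear)
  have inv: "emeasure lborel {c \<in> space lborel. v + f c \<in> X} = emeasure lborel {c \<in> space lborel. f c \<in> X}"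
    if [measurable]: "X \<in> sets borel" for v X
  proof -
    obtain w where w: "v = f w" using assms(2) by blast
    have "emeasure lborel {c. f c \<in> X} = emeasure (distr lborel borel ((+) w)) {c. f c \<in> X}"
      by (simp add: lborel_distr_plus)
    also have "\<dots> = emeasure lborel {c. v + f c \<in> X}"
      using assms(1) by (subst emeasure_distr) (auto simp: w linear_add vimage_def)
    finally show ?thesis by simp
  qed
  obtain k where "\<And>X. X \<in> sets borel \<Longrightarrow> emeasure lborel {c \<in> space lborel. f c \<in> X} = k * emeasure lborel X"
    using translation_invariant_eq_scaled_lborel[OF _ _ inv] lborel.sigma_finite_measure_axioms
    by (metis \<open>f \<in> borel_measurable borel\<close> measurable_lborel2)
  then show ?thesis
    by (intro that[of k]) (simp add: vimage_def)
qed

text \<open>Here \<open>f\<close> is the conjugate of \<open>g\<close> by \<open>P\<close>. The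
  factor by which \<open>P\<close> scales measure enters on both sides of the comparison and cancels
  without being computed.\<close>

lemma similar_vimage_lborel:
  fixes f g P Q :: "'a::euclidean_space \<Rightarrow> 'a"
  assumes lin: "linear P" "linear Q"
    and PQ: "\<And>x. P (Q x) = x" and QP: "\<And>x. Q (P x) = x"
    and [measurable]: "f \<in> borel_measurable borel"
    and fP: "\<And>x. f (P x) = P (g x)"
    and g: "\<And>X. X \<in> sets borel \<Longrightarrow> emeasure lborel (g -` X) = r * emeasure lborel X"
    and X [measurable]: "X \<in> sets borel"
  shows "emeasure lborel (f -` X) = r * emeasure lborel X"
proof -
  have borel: "h -` Y \<in> sets borel" if "h \<in> borel_measurable borel" "Y \<in> sets borel" for h :: "'a \<Rightarrow> 'a" and Y
    using measurable_sets[OF that] by simp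
  have [measurable]: "P \<in> borel_measurable borel" "Q \<in> borel_measurable borel"
    using lin by (simp_all add: borel_measurable_continuous_onI linear_continuous_on linear_linear)
  obtain k where k: "\<And>X. X \<in> sets borel \<Longrightarrow> emeasure lborel (P -` X) = k * emeasure lborel X"
    using linear_vimage_eq_scaled_lborel[OF lin(1)] PQ by (metis surjI)
  obtain k' where k': "\<And>X. X \<in> sets borel \<Longrightarrow> emeasure lborel (Q -` X) = k' * emeasure lborel X"
    using linear_vimage_eq_scaled_lborel[OF lin(2)] QP by (metis surjI)
  \<comment> \<open>Cancelling \<open>k\<close> in \<open>ennreal\<close> requires excluding 0 and
    infinity. The unit cube, of measure 1, shows that \<open>k'\<close> is its inverse.\<close>
  have kk: "k' * k = 1"
  proof -
    let ?Y = "cbox 0 One :: 'a set"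
    have "Q -` P -` ?Y = ?Y" by (auto simp: PQ)
    then have "emeasure lborel ?Y = k' * (k * emeasure lborel ?Y)"
      by (metis k k' borel \<open>P \<in> borel_measurable borel\<close> borel_closed closed_cbox)
    then show ?thesis by (simp add: emeasure_lborel_cbox_eq)
  qed
  have "P -` f -` X = g -` P -` X" by (auto simp: fP)
  then have "k * emeasure lborel (f -` X) = r * (k * emeasure lborel X)"
    by (metis k g borel X \<open>P \<in> borel_measurable borel\<close> \<open>f \<in> borel_measurable borel\<close>)
  then have "k' * k * emeasure lborel (f -` X) = k' * k * (r * emeasure lborel X)"
    by (simp add: ac_simps)
  then show ?thesis by (simp add: kk)
qed

section \<open>Volume in a hyperplane and the diagonal scaling\<close>

text \<open>Every \<open>q\<close> is uniquely a point of the hyperplane plus a multiple of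
  \<open>v\<close>, the multiple being \<open>n \<bullet> q - c\<close>. Coordinates along
  \<open>v\<close> and an orthonormal basis of the direction space therefore parametrize the whole
  space, and Fubini splits off the coordinate along \<open>v\<close>. The direction \<open>v\<close>
  may be oblique; \<open>k\<close> does not depend on \<open>A\<close>.\<close>

lemma affine_lborel_hyperplane_cylinder:
  fixes n v :: "'a::euclidean_space"
  assumes nv: "n \<bullet> v = 1"
  obtains k where "\<And>A. A \<in> sets borel \<Longrightarrow> emeasure (affine_lborel {x. n \<bullet> x = c}) A =
    k * emeasure lborel {q. n \<bullet> q - c \<in> {0..1} \<and> q - (n \<bullet> q - c) *\<^sub>R v \<in> A}"
proof -
  let ?H = "{x. n \<bullet> x = c}"
  have "c *\<^sub>R v \<in> ?H" using nv by simp
  then obtain a B where a: "n \<bullet> a = c" and fin: "finite B"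
    and B: "orthonormal_basis_of ((\<lambda>x. x - a) ` ?H) B"
    and eq: "affine_lborel ?H = distr (\<Pi>\<^sub>M b\<in>B. (lborel :: real measure)) borel (\<lambda>c. a + (\<Sum>b\<in>B. c b *\<^sub>R b))"
    using affine_lborel_choice[OF affine_hyperplane[of n c]] by (metis (mono_tags, lifting) empty_iff mem_Collect_eq)
  interpret product_sigma_finite "\<lambda>_. lborel :: real measure" ..
  have span: "span B = {x. n \<bullet> x = 0}"
  proof -
    have "(\<lambda>x. x - a) ` ?H = {x. n \<bullet> x = 0}"
      by (auto simp: inner_diff_right a inner_add_right intro!: image_eqI[of _ "\<lambda>x. x - a" "_ + a"])
    then show ?thesis using B by (simp add: orthonormal_basis_of_def)
  qed
  have nB: "n \<bullet> (\<Sum>b\<in>B. t b *\<^sub>R b) = 0" for t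
    using span span_sum[of B "\<lambda>b. t b *\<^sub>R b" B] by (auto intro: span_base span_scale)
  have vB: "v \<notin> B" using span span_base[of v B] nv by auto
  let ?M = "\<Pi>\<^sub>M b\<in>insert v B. (lborel :: real measure)"
  let ?f = "\<lambda>t. \<Sum>b\<in>insert v B. t b *\<^sub>R b"
  have f [measurable]: "?f \<in> borel_measurable ?M"
    by measurable
  have inv: "emeasure ?M {t \<in> space ?M. w + ?f t \<in> X} = emeasure ?M {t \<in> space ?M. ?f t \<in> X}"
    if [measurable]: "X \<in> sets borel" for w X
  proof -
    \<comment> \<open>Removing the multiple of \<open>v\<close> leaves a vector of the direction
      space, so \<open>v\<close> and \<open>B\<close> span everything and any translation is a shift
      of coordinates.\<close>
    have "w - (n \<bullet> w) *\<^sub>R v \<in> span B" by (simp add: span inner_diff_right nv)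
    then have "w \<in> span (insert v B)" by (auto simp: span_insert)
    then obtain s where s: "w = ?f s" using fin by (auto simp: span_finite)
    have "emeasure ?M {t \<in> space ?M. ?f t \<in> X} =
      emeasure (distr ?M ?M (\<lambda>t. \<lambda>b\<in>insert v B. s b + t b)) {t \<in> space ?M. ?f t \<in> X}"
      using fin by (simp add: PiM_lborel_translate)
    also have "\<dots> = emeasure ?M {t \<in> space ?M. w + ?f t \<in> X}"
    proof (subst emeasure_distr)
      show "(\<lambda>t. \<lambda>b\<in>insert v B. s b + t b) \<in> ?M \<rightarrow>\<^sub>M ?M" by measurable
      have "?f (\<lambda>b\<in>insert v B. s b + t b) = w + ?f t" for t
        unfolding s sum.distrib[symmetric] by (intro sum.cong) (auto simp: scaleR_add_left)
      then show "emeasure ?M ((\<lambda>t. \<lambda>b\<in>insert v B. s b + t b) -` {t \<in> space ?M. ?f t \<in> X} \<inter> space ?M) =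
        emeasure ?M {t \<in> space ?M. w + ?f t \<in> X}"
        by (intro arg_cong[where f = "emeasure ?M"]) (auto simp: space_PiM)
    qed measurable
    finally show ?thesis by simp
  qed
  have "sigma_finite_measure ?M"
    using fin by (intro sigma_finite) auto
  then obtain k where k: "\<And>X. X \<in> sets borel \<Longrightarrow> emeasure ?M {t \<in> space ?M. ?f t \<in> X} = k * emeasure lborel X"
    using translation_invariant_eq_scaled_lborel[OF _ f inv] by blast
  show ?thesis
  proof (rule that[of k])
    fix A :: "'a set"
    assume A [measurable]: "A \<in> sets borel"
    define X where "X = {q. n \<bullet> q - c \<in> {0..1} \<and> q - (n \<bullet> q - c) *\<^sub>R v \<in> A}"
    let ?g = "\<lambda>t. a + (\<Sum>b\<in>B. t b *\<^sub>R b)"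
    let ?N = "\<Pi>\<^sub>M b\<in>B. (lborel :: real measure)"
    have X [measurable]: "X \<in> sets borel" unfolding X_def by measurable
    \<comment> \<open>The coordinate along \<open>v\<close> is the height over the hyperplane, and
      projecting along \<open>v\<close> recovers the point with the remaining coordinates.\<close>
    have mem: "a + ?f (t(v := y)) \<in> X \<longleftrightarrow> y \<in> {0..1} \<and> ?g t \<in> A" for t y
    proof -
      have f: "?f (t(v := y)) = y *\<^sub>R v + (\<Sum>b\<in>B. t b *\<^sub>R b)"
        using vB fin by (simp cong: sum.cong) (intro sum.cong, auto)
      then have n: "n \<bullet> (a + ?f (t(v := y))) - c = y"
        by (simp add: inner_add_right nB nv a)
      show ?thesis unfolding X_def mem_Collect_eq n unfolding f by simp
    qed
    \<comment> \<open>The base point \<open>a\<close> is introduced by translation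
      invariance.\<close>
    have "k * emeasure lborel X = emeasure ?M {t \<in> space ?M. a + ?f t \<in> X}"
      using inv[of X a] k[of X] X by simp
    also have "\<dots> = (\<integral>\<^sup>+t. indicator X (a + ?f t) \<partial>?M)"
    proof -
      have "(\<integral>\<^sup>+t. indicator X (a + ?f t) \<partial>?M) = (\<integral>\<^sup>+t. indicator {t \<in> space ?M. a + ?f t \<in> X} t \<partial>?M)"
        by (rule nn_integral_cong) (simp add: indicator_def)
      also have "\<dots> = emeasure ?M {t \<in> space ?M. a + ?f t \<in> X}"
        by (rule nn_integral_indicator) measurable
      finally show ?thesis by simp
    qed
    also have "\<dots> = (\<integral>\<^sup>+y. (\<integral>\<^sup>+t. indicator X (a + ?f (t(v := y))) \<partial>?N) \<partial>lborel)"
      using fin vB by (intro product_nn_integral_insert_rev) measurable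
    also have "\<dots> = (\<integral>\<^sup>+y. (\<integral>\<^sup>+t. indicator {0..1::real} y * indicator {t \<in> space ?N. ?g t \<in> A} t \<partial>?N) \<partial>lborel)"
    proof (rule nn_integral_cong, rule nn_integral_cong)
      fix y t
      assume "t \<in> space ?N"
      then show "indicator X (a + ?f (t(v := y))) =
        (indicator {0..1::real} y * indicator {t \<in> space ?N. ?g t \<in> A} t :: ennreal)"
        unfolding indicator_def mem by simp
    qed
    \<comment> \<open>The height ranges over an interval of length 1, so no further factor
      arises.\<close>
    also have "\<dots> = emeasure ?N {t \<in> space ?N. ?g t \<in> A}"
      by (simp add: nn_integral_cmult nn_integral_multc)
    also have "\<dots> = emeasure (affine_lborel ?H) A"
      unfolding eq by (subst emeasure_distr) (auto intro!: arg_cong[where f = "emeasure ?N"])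
    finally show "emeasure (affine_lborel ?H) A = k * emeasure lborel {q. n \<bullet> q - c \<in> {0..1} \<and> q - (n \<bullet> q - c) *\<^sub>R v \<in> A}"
      by (simp add: X_def)
  qed
qed

text \<open>The only place where a scaling factor is computed: the diagonal case of the change of
  variables, where the entry at the basis vector \<open>axis x 1\<close> is
  \<open>d x\<close>.\<close>

lemma lborel_vimage_scale_components:
  fixes d :: "'v::finite \<Rightarrow> real"
  assumes d: "\<And>x. d x > 0" and X [measurable]: "X \<in> sets borel"
  shows "emeasure lborel ((\<lambda>p. \<chi> x. d x * p $ x) -` X) = ennreal (\<Prod>x\<in>UNIV. 1 / d x) * emeasure lborel X"
proof -
  let ?c = "\<lambda>j. (\<chi> x. d x) \<bullet> j"
  let ?T = "\<lambda>p. 0 + (\<Sum>j\<in>Basis. (?c j * (p \<bullet> j)) *\<^sub>R j) :: real ^ 'v"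
  have B: "(Basis :: (real ^ 'v) set) = range (\<lambda>i. axis i 1)"
    by (auto simp: Basis_vec_def)
  have inj: "inj (\<lambda>i::'v. axis i (1::real))"
    by (auto simp: inj_on_def axis_eq_axis)
  have T: "?T = (\<lambda>p. \<chi> x. d x * p $ x)"
    by (simp add: fun_eq_iff vec_eq_iff B sum.reindex[OF inj] inner_axis) (simp add: axis_def if_distrib cong: if_cong)
  have T_meas [measurable]: "?T \<in> borel_measurable borel" by measurable
  have c: "?c j \<noteq> 0" if "j \<in> Basis" for j
    using that d by (force simp: B inner_axis dest: less_imp_neq)
  have prod: "(\<Prod>j\<in>Basis. \<bar>?c j\<bar>) = (\<Prod>x\<in>UNIV. d x)"
    using d by (simp add: B prod.reindex[OF inj] inner_axis abs_of_pos)
  have "emeasure lborel X = emeasure (density (distr lborel borel ?T) (\<lambda>_. (\<Prod>j\<in>Basis. \<bar>?c j\<bar>))) X"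
    using lborel_affine_euclidean[of ?c 0] c by simp
  also have "\<dots> = ennreal (\<Prod>x\<in>UNIV. d x) * emeasure lborel (?T -` X)"
    unfolding prod by (simp add: emeasure_density nn_integral_cmult emeasure_distr)
  finally have "emeasure lborel X = ennreal (\<Prod>x\<in>UNIV. d x) * emeasure lborel (?T -` X)" .
  moreover have "ennreal (\<Prod>x\<in>UNIV. 1 / d x) * ennreal (\<Prod>x\<in>UNIV. d x) = 1"
    using d by (subst ennreal_mult[symmetric])
      (auto intro!: prod_nonneg less_imp_le[OF prod_pos] simp: prod.distrib[symmetric] less_imp_neq[THEN not_sym] simp del: prod_dividef)
  ultimately show ?thesis
    unfolding T by (simp add: mult.assoc[symmetric])
qed

section \<open>The linear map from the polytope to the simplex\<close>

theorem proposition5: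
  fixes adj :: "'v::finite \<Rightarrow> 'v \<Rightarrow> bool"
    and C :: "'v set"
  assumes "symp adj"
    and "irreflp adj"
    and "independent_set adj C"
  shows "vol (strong_mode_polytope adj C) =
    (\<Prod>x\<in>UNIV. 1 / (real (card (nbrs_in adj C x)) + 1)) * vol (prob_simplex :: (real ^ 'v) set)"
\<comment> \<open>The cylinder direction will be taken at a point of \<open>C\<close>; without such
  a point the polytope is the simplex and all factors are 1.\<close>
proof (cases "C = {}")
  case True
  then show ?thesis
    by (simp add: strong_mode_polytope_def nbrs_in_def)
next
  case False
  then obtain x0 where x0: "x0 \<in> C" by blast
  define d where "d = (\<lambda>x. real (card (nbrs_in adj C x)))"
  define L where "L = (\<lambda>p :: real ^ 'v. \<chi> x. (d x + 1) * p $ x - (if x \<in> C then \<Sum>y | adj y x. p $ y else 0))"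
  \<comment> \<open>The conjugating maps are \<open>p - N p\<close> and \<open>p + N p\<close>. They
    are mutually inverse since \<open>N\<close> reads coordinates outside \<open>C\<close> only and
    writes to those in \<open>C\<close>, so \<open>N\<close> squares to zero. The divisors that
    occur are positive by \<open>d_pos\<close>.\<close>
  define N where "N = (\<lambda>p :: real ^ 'v. \<chi> x. if x \<in> C then \<Sum>y | adj y x. p $ y / d y else 0)"
  have nC: "y \<notin> C" if "adj y x" "x \<in> C" for x y
    using assms(3) that by (auto simp: independent_set_def)
  have dC: "d x = 0" if "x \<in> C" for x
    using nC that by (auto simp: d_def nbrs_in_def)
  have d_pos: "d y > 0" if "adj y x" "x \<in> C" for x y
    using that assms(1) by (auto simp: d_def nbrs_in_def card_gt_0_iff dest: sympD)
  have linN: "linear N" and linL: "linear L"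
    by (rule linearI; auto simp: N_def L_def vec_eq_iff sum.distrib add_divide_distrib sum_distrib_left algebra_simps)+
  have NN: "N (N p) = 0" for p
    using nC by (auto simp: N_def vec_eq_iff intro!: sum.neutral)
  have L_borel [measurable]: "L \<in> borel_measurable borel"
    using linL by (simp add: borel_measurable_continuous_onI linear_continuous_on linear_linear)
  have scale: "emeasure lborel (L -` X) = ennreal (\<Prod>x\<in>UNIV. 1 / (d x + 1)) * emeasure lborel X"
    if X: "X \<in> sets borel" for X
  proof (rule similar_vimage_lborel[where P = "\<lambda>p. p - N p" and Q = "\<lambda>p. p + N p"
        and g = "\<lambda>p. \<chi> x. (d x + 1) * p $ x"])
    show "linear (\<lambda>p. p - N p)" "linear (\<lambda>p. p + N p)"
      using linN by (auto intro: linear_compose_sub linear_compose_add linear_ident)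
    show "x + N x - N (x + N x) = x" "x - N x + N (x - N x) = x" for x
      by (simp_all add: linear_add[OF linN] linear_diff[OF linN] NN)
    show "L (p - N p) = (\<chi> x. (d x + 1) * p $ x) - N (\<chi> x. (d x + 1) * p $ x)" for p
    unfolding vec_eq_iff
    proof
      fix x
      show "L (p - N p) $ x = ((\<chi> x. (d x + 1) * p $ x) - N (\<chi> x. (d x + 1) * p $ x)) $ x"
      proof (cases "x \<in> C")
        case True
        have "(\<Sum>y | adj y x. (p - N p) $ y) = (\<Sum>y | adj y x. p $ y)"
          using nC True by (intro sum.cong) (auto simp: N_def)
        \<comment> \<open>The identity \<open>(d y + 1) / d y = 1 + 1 / d y\<close> is what dictates
          the weights \<open>1 / d y\<close> in \<open>N\<close>.\<close>
        moreover have "(\<Sum>y | adj y x. (d y + 1) * p $ y / d y) = (\<Sum>y | adj y x. p $ y + p $ y / d y)"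
          using d_pos[OF _ True] by (intro sum.cong) (force simp: field_simps)+
        ultimately show ?thesis
          using True by (simp add: L_def N_def dC sum.distrib)
      qed (simp add: L_def N_def)
    qed
    show "emeasure lborel ((\<lambda>p. \<chi> x. (d x + 1) * p $ x) -` Y) =
      ennreal (\<Prod>x\<in>UNIV. 1 / (d x + 1)) * emeasure lborel Y" if "Y \<in> sets borel" for Y :: "(real ^ 'v) set"
      using that by (intro lborel_vimage_scale_components) (auto simp: d_def add_nonneg_pos)
  qed (use X L_borel in auto)
  have sumL: "(\<Sum>x\<in>UNIV. L p $ x) = (\<Sum>x\<in>UNIV. p $ x)" for p
  proof -
    \<comment> \<open>Double counting of adjacent pairs with one end in \<open>C\<close>: what the
      factors add to the total is exactly what is subtracted at the points of
      \<open>C\<close>.\<close>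
    have "(\<Sum>x\<in>UNIV. d x * p $ x) = (\<Sum>x\<in>UNIV. \<Sum>y\<in>UNIV. if y \<in> C \<and> adj y x then p $ x else 0)"
      by (simp add: d_def nbrs_in_def sum.If_cases Int_def conj_commute)
    also have "\<dots> = (\<Sum>y\<in>UNIV. \<Sum>x\<in>UNIV. if y \<in> C \<and> adj y x then p $ x else 0)"
      by (rule sum.swap)
    also have "\<dots> = (\<Sum>y\<in>UNIV. if y \<in> C then \<Sum>x | adj x y. p $ x else 0)"
      using assms(1) by (intro sum.cong refl) (auto simp: sum.If_cases symp_def intro!: sum.cong)
    finally show ?thesis
      by (simp add: L_def sum_subtractf sum.distrib distrib_right)
  qed
  have simplex: "L p \<in> prob_simplex \<longleftrightarrow> p \<in> strong_mode_polytope adj C" for p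
  proof -
    \<comment> \<open>At a point of \<open>C\<close> the coordinate of \<open>L p\<close> is the
      slack in the strong mode inequality; elsewhere it is a positive multiple of that of
      \<open>p\<close>. Nonnegativity on \<open>C\<close> follows from that on the neighbours, which
      lie outside \<open>C\<close>.\<close>
    have "(\<forall>x. 0 \<le> L p $ x) \<longleftrightarrow> (\<forall>x. 0 \<le> p $ x) \<and> (\<forall>x\<in>C. (\<Sum>y | adj y x. p $ y) \<le> p $ x)"
    proof (intro iffI conjI allI ballI)
      assume pos: "\<forall>x. 0 \<le> L p $ x"
      show mode: "(\<Sum>y | adj y x. p $ y) \<le> p $ x" if "x \<in> C" for x
        using pos[rule_format, of x] that by (simp add: L_def dC)
      have out: "0 \<le> p $ x" if "x \<notin> C" for x
        using pos[rule_format, of x] that by (simp add: L_def d_def zero_le_mult_iff)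
      show "0 \<le> p $ x" for x
      proof (cases "x \<in> C")
        case True
        have "0 \<le> (\<Sum>y | adj y x. p $ y)"
          using nC True by (intro sum_nonneg out) auto
        then show ?thesis using mode[OF True] by linarith
      qed (rule out)
    next
      fix x
      assume "(\<forall>x. 0 \<le> p $ x) \<and> (\<forall>x\<in>C. (\<Sum>y | adj y x. p $ y) \<le> p $ x)"
      then show "0 \<le> L p $ x"
        by (cases "x \<in> C") (simp_all add: L_def dC, simp add: d_def)
    qed
    then show ?thesis
      using sumL[of p] by (auto simp: prob_simplex_def strong_mode_polytope_def strong_mode_def)
  qed
  define v :: "real ^ 'v" where "v = axis x0 1"
  define cyl where "cyl = (\<lambda>A. {q :: real ^ 'v. 1 \<bullet> q - 1 \<in> {0..1} \<and> q - (1 \<bullet> q - 1) *\<^sub>R v \<in> A})"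
  have inner1: "1 \<bullet> p = (\<Sum>x\<in>UNIV. p $ x)" for p :: "real ^ 'v"
    by (simp add: inner_vec_def)
  have Lv: "L v = v"
    using x0 nC dC by (auto simp: L_def v_def vec_eq_iff axis_def intro!: sum.neutral)
  have H: "(prob_hyperplane :: (real ^ 'v) set) = {p. 1 \<bullet> p = 1}"
    by (simp add: prob_hyperplane_def inner1)
  have "1 \<bullet> v = 1"
    by (simp add: v_def inner_axis)
  then obtain k where k: "\<And>A. A \<in> sets borel \<Longrightarrow>
      emeasure (affine_lborel prob_hyperplane) A = k * emeasure lborel (cyl A)"
    unfolding cyl_def H using affine_lborel_hyperplane_cylinder by blast
  have "closed (prob_simplex :: (real ^ 'v) set)"
    unfolding prob_simplex_def by (intro closed_Collect_conj closed_Collect_all closed_Collect_le closed_Collect_eq continuous_intros)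
  then have \<Delta> [measurable]: "(prob_simplex :: (real ^ 'v) set) \<in> sets borel"
    by (rule borel_closed)
  have S_eq: "strong_mode_polytope adj C = L -` prob_simplex"
    using simplex by auto
  have S: "strong_mode_polytope adj C \<in> sets borel"
    unfolding S_eq using measurable_sets[OF L_borel \<Delta>] by simp
  have cyl_S: "cyl (strong_mode_polytope adj C) = L -` cyl prob_simplex"
    by (auto simp: cyl_def S_eq linear_diff[OF linL] linear_scale[OF linL] Lv inner1 sumL)
  have "cyl prob_simplex \<in> sets borel"
    unfolding cyl_def by measurable
  then have "emeasure (affine_lborel prob_hyperplane) (strong_mode_polytope adj C) =
      ennreal (\<Prod>x\<in>UNIV. 1 / (d x + 1)) * emeasure (affine_lborel prob_hyperplane) (prob_simplex :: (real ^ 'v) set)"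
    by (simp only: k[OF S] k[OF \<Delta>] cyl_S scale mult.left_commute)
  moreover have "0 \<le> (\<Prod>x\<in>UNIV. 1 / (d x + 1))"
    by (intro prod_nonneg) (simp add: d_def)
  ultimately show ?thesis
    by (simp add: vol_def measure_def enn2real_mult d_def)
qed

end
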